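(* Let $G$ be a finite group. Then $G$ is a non-cyclic group of prime exponent if and only if the power graph $\mathcal{G}(G)$ is non-complete and minimally edge-connected.
   Context: The power graph $\mathcal{G}(G)$ of a group $G$ is the simple undirected graph with vertex set $G$ in which two distinct vertices $u,v$ are adjacent if and only if $v=u^n$ for some positive integer $n$ or $u=v^m$ for some positive integer $m$. For a graph $\Gamma$, $\kappa'(\Gamma)$ denotes its edge-connectivity (minimum number of edges whose removal disconnects $\Gamma$). A non-trivial connected graph $\Gamma$ is minimally edge-connected if $\kappa'(\Gamma-\varepsilon)=\kappa'(\Gamma)-1$ for every edge $\varepsilon$ of $\Gamma$. A group has prime exponent if there is a prime $p$ with $x^p=e$ for all $x\in G$. *)

theory Defs
  imports
    "HOL-Computational_Algebra.Primes"
    "HOL-Algebra.Elementary_Groups"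
    "Graph_Theory.Graph_Theory"
begin

text \<open>
  Following Graph_Theory, a finite simple undirected graph is a \<^const>\<open>pair_graph\<close>: a loop-free
  symmetric arc relation on a finite vertex set. An undirected edge is the unordered pair
  underlying the two arcs \<open>(u, v)\<close> and \<open>(v, u)\<close>, so that deleting an edge deletes both arcs and
  cardinalities count undirected edges.
\<close>

definition edges :: "'a pair_pre_digraph \<Rightarrow> 'a set set" where
  "edges \<Gamma> = {{u, v} | u v. (u, v) \<in> parcs \<Gamma>}"

definition del_edges :: "'a pair_pre_digraph \<Rightarrow> 'a set set \<Rightarrow> 'a pair_pre_digraph" where
  "del_edges \<Gamma> F = \<lparr> pverts = pverts \<Gamma>, parcs = {(u, v) \<in> parcs \<Gamma>. {u, v} \<notin> F} \<rparr>"

text \<open>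
  No set of edges disconnects a one-vertex graph; its edge-connectivity is 0 by convention.
\<close>

definition edge_connectivity :: "'a pair_pre_digraph \<Rightarrow> nat" where
  "edge_connectivity \<Gamma> =
     (if card (pverts \<Gamma>) \<le> 1 then 0
      else LEAST k. \<exists>F \<subseteq> edges \<Gamma>. finite F \<and> card F = k \<and> \<not> connected (with_proj (del_edges \<Gamma> F)))"

definition minimally_edge_connected :: "'a pair_pre_digraph \<Rightarrow> bool" where
  "minimally_edge_connected \<Gamma> \<longleftrightarrow>
     card (pverts \<Gamma>) > 1 \<and> connected (with_proj \<Gamma>) \<and>
     (\<forall>\<epsilon> \<in> edges \<Gamma>.
        int (edge_connectivity (del_edges \<Gamma> {\<epsilon>})) = int (edge_connectivity \<Gamma>) - 1)"

definition complete_graph :: "'a pair_pre_digraph \<Rightarrow> bool" where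
  "complete_graph \<Gamma> \<longleftrightarrow> (\<exists>n. complete_digraph n (with_proj \<Gamma>))"

definition power_graph :: "('a, 'b) monoid_scheme \<Rightarrow> 'a pair_pre_digraph" where
  "power_graph G =
     \<lparr> pverts = carrier G,
       parcs = {(u, v). u \<in> carrier G \<and> v \<in> carrier G \<and> u \<noteq> v \<and>
                  ((\<exists>n::nat. n > 0 \<and> v = u [^]\<^bsub>G\<^esub> n) \<or> (\<exists>m::nat. m > 0 \<and> u = v [^]\<^bsub>G\<^esub> m))} \<rparr>"

definition prime_exponent :: "('a, 'b) monoid_scheme \<Rightarrow> bool" where
  "prime_exponent G \<longleftrightarrow>
     (\<exists>p::nat. Factorial_Ring.prime p \<and> (\<forall>x \<in> carrier G. x [^]\<^bsub>G\<^esub> p = \<one>\<^bsub>G\<^esub>))"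

lemma pair_graph_power_graph:
  assumes "finite (carrier G)"
  shows "pair_graph (power_graph G)"
proof -
  have V: "pverts (power_graph G) = carrier G"
    by (simp add: power_graph_def)
  have A: "u \<in> carrier G" "v \<in> carrier G" "u \<noteq> v" if "(u, v) \<in> parcs (power_graph G)" for u v
    using that by (simp_all add: power_graph_def)
  have S: "(v, u) \<in> parcs (power_graph G)" if "(u, v) \<in> parcs (power_graph G)" for u v
    using that unfolding power_graph_def by simp blast
  show ?thesis
  proof
    show "finite (parcs (power_graph G))"
      by (rule finite_subset[of _ "carrier G \<times> carrier G"]) (auto dest: A simp: assms)
    show "symmetric (with_proj (power_graph G))"
      by (simp add: symmetric_def sym_def S)
  qed (auto simp: V assms dest: A)
qed

lemma pair_graph_del_edges:
  assumes "pair_graph \<Gamma>"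
  shows "pair_graph (del_edges \<Gamma> F)"
proof -
  interpret pair_graph \<Gamma> by fact
  have A: "u \<in> pverts \<Gamma>" "v \<in> pverts \<Gamma>" "u \<noteq> v" if "(u, v) \<in> parcs \<Gamma>" for u v
    using that wellformed' pair_no_loops by fastforce+
  have S: "(v, u) \<in> parcs \<Gamma>" if "(u, v) \<in> parcs \<Gamma>" for u v
    using that pair_sym_arcs by (simp add: symmetric_def sym_def)
  show ?thesis
  proof
    show "finite (parcs (del_edges \<Gamma> F))"
      by (rule finite_subset[OF _ pair_finite_arcs]) (auto simp: del_edges_def)
    show "symmetric (with_proj (del_edges \<Gamma> F))"
      by (simp add: del_edges_def symmetric_def sym_def insert_commute S)
  qed (auto simp: del_edges_def pair_finite_verts dest: A)
qed

lemma complete_graph_iff: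
  assumes "pair_graph \<Gamma>"
  shows "complete_graph \<Gamma> \<longleftrightarrow> (\<forall>u \<in> pverts \<Gamma>. \<forall>v \<in> pverts \<Gamma>. u \<noteq> v \<longrightarrow> (u, v) \<in> parcs \<Gamma>)"
proof -
  interpret pair_graph \<Gamma> by fact
  have A: "u \<in> pverts \<Gamma> \<and> v \<in> pverts \<Gamma> \<and> u \<noteq> v" if "(u, v) \<in> parcs \<Gamma>" for u v
    using that wellformed' pair_no_loops by fastforce
  show ?thesis
    unfolding complete_graph_def complete_digraph_pair_def
    by (simp add: pair_finite_verts set_eq_iff) (use A in blast)
qed

end

theory Submission
  imports
    Defs
    "HOL-Algebra.Multiplicative_Group"
    "HOL-Algebra.Sylow"
    "HOL-Algebra.Group_Action"
    "HOL-Number_Theory.Totient"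
begin

text \<open>
  In a graph with a vertex \<open>e\<close> adjacent to all others, a vertex \<open>x \<noteq> e\<close> of degree \<open>k\<close> is joined to
  \<open>e\<close> by \<open>k\<close> edge-disjoint paths. Hence the graph is minimally edge-connected iff all vertices other
  than \<open>e\<close> have the same degree. In a power graph take \<open>e\<close> to be the identity, and suppose that all
  closed neighbourhoods of the other elements have size \<open>d\<close>. A generator of a maximal cyclic
  subgroup is adjacent to that subgroup only, so all maximal cyclic subgroups have order \<open>d\<close>.
  For a prime \<open>q\<close> properly dividing \<open>d\<close>, an element of order \<open>d / q\<close> has \<open>d - d / q\<close> neighbours of
  order \<open>d\<close>, and these fall into sets of generators of size \<open>totient d\<close>; for \<open>q = 2\<close>, or any \<open>q\<close>
  if \<open>d\<close> is odd, a parity argument shows that \<open>d\<close> is a power of \<open>q\<close>. Then \<open>G\<close> is a \<open>q\<close>-group,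
  and if \<open>d \<noteq> q\<close>, a central element of order \<open>q\<close> is adjacent to everything, so that the power
  graph is complete.
\<close>

section \<open>Edge connectivity in graphs with a dominating vertex\<close>

definition neighbours :: "'a pair_pre_digraph \<Rightarrow> 'a \<Rightarrow> 'a set" where
  "neighbours \<Gamma> x = {y. (x, y) \<in> parcs \<Gamma>}"

text \<open>An edge cut with one side named; unordered pairs make its size comparable with that of
  the sets deleted in \<open>edge_connectivity\<close>.\<close>

definition edge_boundary :: "'a pair_pre_digraph \<Rightarrow> 'a set \<Rightarrow> 'a set set" where
  "edge_boundary \<Gamma> A = {{u, v} | u v. (u, v) \<in> parcs \<Gamma> \<and> u \<in> A \<and> v \<notin> A}"

lemma edge_boundary_subset: "edge_boundary \<Gamma> A \<subseteq> edges \<Gamma>"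
  by (auto simp: edge_boundary_def edges_def)

lemma pverts_del_edges [simp]: "pverts (del_edges \<Gamma> F) = pverts \<Gamma>"
  by (simp add: del_edges_def)

lemma edge_boundary_del_edges: "edge_boundary (del_edges \<Gamma> F) A = edge_boundary \<Gamma> A - F"
  by (auto simp: edge_boundary_def del_edges_def)

context pair_graph
begin

lemma parcs_in_pverts:
  assumes "(u, v) \<in> parcs G"
  shows "u \<in> pverts G" "v \<in> pverts G" "u \<noteq> v" "(v, u) \<in> parcs G"
  using assms wellformed' pair_no_loops pair_sym_arcs
  by (fastforce simp: symmetric_def sym_def)+

lemma finite_edges: "finite (edges G)"
proof -
  have "edges G \<subseteq> (\<lambda>(u, v). {u, v}) ` parcs G"
    by (auto simp: edges_def)
  then show ?thesis
    by (rule finite_subset) (simp add: pair_finite_arcs)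
qed

lemma finite_edge_boundary: "finite (edge_boundary G A)"
  using finite_edges edge_boundary_subset by (rule rev_finite_subset)

lemma finite_neighbours: "finite (neighbours G x)"
  by (rule finite_subset[OF _ pair_finite_verts]) (auto simp: neighbours_def dest: parcs_in_pverts)

lemma connected_iff_reachable:
  "connected (with_proj G) \<longleftrightarrow> pverts G \<noteq> {} \<and> (\<forall>u \<in> pverts G. \<forall>v \<in> pverts G. u \<rightarrow>\<^sup>*\<^bsub>with_proj G\<^esub> v)"
  using symmetric_connected_imp_strongly_connected[OF pair_sym_arcs]
  by (auto simp: connected_def strongly_connected_def reachable_mk_symmetric_eq pair_sym_arcs)

text \<open>A cut has two sides, and \<open>A\<close> is always taken to be the one that avoids
  \<open>e\<close>: later all its vertices are adjacent to \<open>e\<close>.\<close>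

lemma not_connected_iff_edge_boundary:
  assumes "e \<in> pverts G"
  shows "\<not> connected (with_proj G) \<longleftrightarrow>
    (\<exists>A \<subseteq> pverts G. A \<noteq> {} \<and> e \<notin> A \<and> edge_boundary G A = {})"
proof
  assume "\<not> connected (with_proj G)"
  then obtain u v where uv: "u \<in> pverts G" "v \<in> pverts G" "\<not> u \<rightarrow>\<^sup>*\<^bsub>with_proj G\<^esub> v"
    using assms by (auto simp: connected_iff_reachable)
  have sym: "y \<rightarrow>\<^sup>*\<^bsub>with_proj G\<^esub> x" if "x \<rightarrow>\<^sup>*\<^bsub>with_proj G\<^esub> y" for x y
    using that by (rule symmetric_reachable[OF pair_sym_arcs])
  \<comment> \<open>The complement of the component of \<open>e\<close>.\<close>
  define A where "A = {x \<in> pverts G. \<not> e \<rightarrow>\<^sup>*\<^bsub>with_proj G\<^esub> x}"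
  have "A \<noteq> {}"
    using uv sym reachable_trans unfolding A_def by blast
  moreover have "e \<rightarrow>\<^sup>*\<^bsub>with_proj G\<^esub> x" if "(x, y) \<in> parcs G" "e \<rightarrow>\<^sup>*\<^bsub>with_proj G\<^esub> y" for x y
    using that parcs_in_pverts(4)[OF that(1)] reachable_adj_trans[OF that(2), of x] by simp
  then have "edge_boundary G A = {}"
    by (auto simp: A_def edge_boundary_def dest: parcs_in_pverts)
  ultimately show "\<exists>A \<subseteq> pverts G. A \<noteq> {} \<and> e \<notin> A \<and> edge_boundary G A = {}"
    using assms by (intro exI[of _ A]) (auto simp: A_def)
next
  assume "\<exists>A \<subseteq> pverts G. A \<noteq> {} \<and> e \<notin> A \<and> edge_boundary G A = {}"
  then obtain A a where A: "A \<subseteq> pverts G" "a \<in> A" "e \<notin> A" "edge_boundary G A = {}"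
    by blast
  have "y \<in> A" if "a \<rightarrow>\<^sup>*\<^bsub>with_proj G\<^esub> y" for y
    using that
  proof (induction rule: reachable_induct)
    case (step x y)
    then show ?case using A(4) by (auto simp: edge_boundary_def)
  qed (use A(2) in simp)
  then show "\<not> connected (with_proj G)"
    using A assms by (auto simp: connected_iff_reachable)
qed

text \<open>The passage from arbitrary edge sets to cuts: deleting \<open>F\<close> empties exactly
  the cuts contained in \<open>F\<close>.\<close>

lemma not_connected_del_edges_iff:
  assumes "e \<in> pverts G"
  shows "\<not> connected (with_proj (del_edges G F)) \<longleftrightarrow>
    (\<exists>A \<subseteq> pverts G. A \<noteq> {} \<and> e \<notin> A \<and> edge_boundary G A \<subseteq> F)"
  using pair_graph.not_connected_iff_edge_boundary[OF pair_graph_del_edges, of G e F] assms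
    pair_graph_axioms
  by (simp add: edge_boundary_del_edges)

lemma edge_connectivity_le_edge_boundary:
  assumes "e \<in> pverts G" "A \<subseteq> pverts G" "A \<noteq> {}" "e \<notin> A"
  shows "edge_connectivity G \<le> card (edge_boundary G A)"
proof (cases "card (pverts G) \<le> 1")
  case False
  have "\<not> connected (with_proj (del_edges G (edge_boundary G A)))"
    unfolding not_connected_del_edges_iff[OF assms(1)] using assms by blast
  then show ?thesis
    using False finite_edge_boundary[of A] edge_boundary_subset[of G A]
    unfolding edge_connectivity_def by (subst if_not_P) (blast intro: Least_le)+
qed (simp add: edge_connectivity_def)

text \<open>A minimum disconnecting set contains a cut, and that cut disconnects by itself, so the
  minimum is attained at a cut.\<close>

lemma edge_connectivity_eq_edge_boundary:
  assumes "e \<in> pverts G" "card (pverts G) > 1"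
  obtains A where "A \<subseteq> pverts G" "A \<noteq> {}" "e \<notin> A"
    "edge_connectivity G = card (edge_boundary G A)"
proof -
  let ?P = "\<lambda>k. \<exists>F \<subseteq> edges G. finite F \<and> card F = k \<and> \<not> connected (with_proj (del_edges G F))"
  \<comment> \<open>Isolating one vertex other than \<open>e\<close> shows that \<open>LEAST\<close>
    ranges over a nonempty set.\<close>
  obtain x where "x \<in> pverts G" "x \<noteq> e"
    using assms card_le_Suc0_iff_eq[OF pair_finite_verts] by (metis One_nat_def not_le)
  then have "\<not> connected (with_proj (del_edges G (edge_boundary G {x})))"
    unfolding not_connected_del_edges_iff[OF assms(1)] by blast
  then have "?P (card (edge_boundary G {x}))"
    using finite_edge_boundary edge_boundary_subset by blast
  then have "?P (Least ?P)"
    by (rule LeastI)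
  then obtain F where F: "F \<subseteq> edges G" "finite F" "card F = edge_connectivity G"
      "\<not> connected (with_proj (del_edges G F))"
    using assms by (auto simp: edge_connectivity_def)
  then obtain A where A: "A \<subseteq> pverts G" "A \<noteq> {}" "e \<notin> A" "edge_boundary G A \<subseteq> F"
    unfolding not_connected_del_edges_iff[OF assms(1)] by blast
  have "card (edge_boundary G A) \<le> edge_connectivity G"
    using A(4) F by (metis card_mono)
  with edge_connectivity_le_edge_boundary[OF assms(1) A(1-3)] show ?thesis
    using A(1-3) by (intro that) simp_all
qed

lemma card_edge_boundary_singleton: "card (edge_boundary G {x}) = card (neighbours G x)"
proof -
  have "edge_boundary G {x} = (\<lambda>y. {x, y}) ` neighbours G x"
    by (auto simp: edge_boundary_def neighbours_def dest: parcs_in_pverts)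
  moreover have "inj_on (\<lambda>y. {x, y}) (neighbours G x)"
    by (auto simp: inj_on_def doubleton_eq_iff)
  ultimately show ?thesis
    by (simp add: card_image)
qed

text \<open>The paths \<open>e, x\<close> and \<open>e, y, x\<close>, for \<open>y\<close> a neighbour of \<open>x\<close> other than \<open>e\<close>, are
  edge-disjoint, and each of them crosses the boundary of \<open>A\<close>.\<close>

lemma card_neighbours_le_edge_boundary:
  assumes dom: "\<And>x. x \<in> pverts G \<Longrightarrow> x \<noteq> e \<Longrightarrow> (x, e) \<in> parcs G"
    and A: "A \<subseteq> pverts G" "e \<notin> A" "x \<in> A"
  shows "card (neighbours G x) \<le> card (edge_boundary G A)"
proof (rule card_inj_on_le)
  \<comment> \<open>Selects the crossing edge on each path. The path \<open>e, x\<close> is the case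
    \<open>y = e\<close> of the second branch, as \<open>e\<close> is not in
    \<open>A\<close>.\<close>
  let ?f = "\<lambda>y. if y \<in> A then {y, e} else {x, y}"
  show "inj_on ?f (neighbours G x)"
    using A(2,3)
    by (auto simp: inj_on_def neighbours_def doubleton_eq_iff dest: parcs_in_pverts split: if_splits)
  show "?f ` neighbours G x \<subseteq> edge_boundary G A"
    using A dom by (auto simp: edge_boundary_def neighbours_def)
qed (rule finite_edge_boundary)

text \<open>A cut around \<open>x\<close> has at least as many edges as \<open>x\<close> has
  neighbours, and \<open>{x}\<close> attains this. If deleting \<open>{x, e}\<close> lowers the
  connectivity, some minimum cut separates \<open>x\<close> from \<open>e\<close>, so
  \<open>x\<close> has minimum degree. Conversely, every edge has an endpoint
  \<open>u \<noteq> e\<close>, and with equal degrees \<open>{u}\<close> is a minimum cut containing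
  that edge.\<close>

theorem minimally_edge_connected_iff_neighbours:
  assumes e: "e \<in> pverts G" and dom: "\<And>x. x \<in> pverts G \<Longrightarrow> x \<noteq> e \<Longrightarrow> (x, e) \<in> parcs G"
    and card: "card (pverts G) > 1"
  shows "minimally_edge_connected G \<longleftrightarrow>
    (\<exists>k. \<forall>x \<in> pverts G - {e}. card (neighbours G x) = k)"
proof
  assume min: "minimally_edge_connected G"
  have "card (neighbours G x) = edge_connectivity G" if x: "x \<in> pverts G - {e}" for x
  proof -
    let ?\<epsilon> = "{x, e}" and ?H = "del_edges G {{x, e}}"
    interpret H: pair_graph ?H
      using pair_graph_axioms by (rule pair_graph_del_edges)
    have "?\<epsilon> \<in> edges G"
      using x dom by (auto simp: edges_def)
    with min have ec: "edge_connectivity G = Suc (edge_connectivity ?H)"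
      by (force simp: minimally_edge_connected_def)
    obtain A where A: "A \<subseteq> pverts G" "A \<noteq> {}" "e \<notin> A"
        "edge_connectivity ?H = card (edge_boundary G A - {?\<epsilon>})"
      using H.edge_connectivity_eq_edge_boundary[of e] e card
      by (auto simp: edge_boundary_del_edges)
    have le: "edge_connectivity G \<le> card (edge_boundary G A)"
      using e A(1-3) by (rule edge_connectivity_le_edge_boundary)
    \<comment> \<open>A cut without this edge would keep its size, which would then be one below the
      minimum.\<close>
    with A(4) ec have "?\<epsilon> \<in> edge_boundary G A"
      by (metis Diff_insert0 Diff_empty not_less_eq_eq order_refl)
    with A(3) have "x \<in> A"
      by (auto simp: edge_boundary_def doubleton_eq_iff)
    then have "card (neighbours G x) \<le> card (edge_boundary G A)"
      using dom A by (intro card_neighbours_le_edge_boundary)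
    also have "\<dots> = edge_connectivity G"
      using A(4) ec \<open>?\<epsilon> \<in> edge_boundary G A\<close> finite_edge_boundary
      by (metis card_Suc_Diff1)
    finally show ?thesis
      using edge_connectivity_le_edge_boundary[of e "{x}"] e x
      by (auto simp: card_edge_boundary_singleton intro: le_antisym)
  qed
  then show "\<exists>k. \<forall>x \<in> pverts G - {e}. card (neighbours G x) = k"
    by blast
next
  assume "\<exists>k. \<forall>x \<in> pverts G - {e}. card (neighbours G x) = k"
  then obtain k where k: "\<And>x. x \<in> pverts G \<Longrightarrow> x \<noteq> e \<Longrightarrow> card (neighbours G x) = k"
    by blast
  obtain x where x: "x \<in> pverts G" "x \<noteq> e"
    using card card_le_Suc0_iff_eq[OF pair_finite_verts] e by (metis One_nat_def not_le)
  have le: "k \<le> card (edge_boundary G A)" if "A \<subseteq> pverts G" "A \<noteq> {}" "e \<notin> A" for A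
    using card_neighbours_le_edge_boundary[OF dom that(1,3)] that k by blast
  have ec: "edge_connectivity G = k"
    using edge_connectivity_eq_edge_boundary[OF e card] le x k
      edge_connectivity_le_edge_boundary[of e "{x}"] e
    by (metis card_edge_boundary_singleton empty_subsetI insert_not_empty insert_subset
        le_antisym singleton_iff)
  have "e \<in> neighbours G x"
    using dom x by (simp add: neighbours_def)
  with k[OF x] have "k > 0"
    by (metis card_gt_0_iff empty_iff finite_neighbours)
  have "edge_boundary G A \<noteq> {}" if "A \<subseteq> pverts G" "A \<noteq> {}" "e \<notin> A" for A
    using le[OF that] \<open>k > 0\<close> by auto
  then have "connected (with_proj G)"
    using not_connected_iff_edge_boundary[OF e] by blast
  moreover have "Suc (edge_connectivity (del_edges G {\<epsilon>})) = k" if \<epsilon>: "\<epsilon> \<in> edges G" for \<epsilon>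
  proof -
    interpret H: pair_graph "del_edges G {\<epsilon>}"
      using pair_graph_axioms by (rule pair_graph_del_edges)
    obtain u v where uv: "\<epsilon> = {u, v}" "(u, v) \<in> parcs G" "u \<noteq> e"
    proof -
      obtain a b where ab: "\<epsilon> = {a, b}" "(a, b) \<in> parcs G"
        using \<epsilon> by (auto simp: edges_def)
      then show ?thesis
        using that[of a b] that[of b a] parcs_in_pverts(3,4)[OF ab(2)] by (auto simp: insert_commute)
    qed
    then have u: "u \<in> pverts G" "\<epsilon> \<in> edge_boundary G {u}"
      by (auto simp: edge_boundary_def dest: parcs_in_pverts)
    have "edge_connectivity (del_edges G {\<epsilon>}) \<le> card (edge_boundary G {u} - {\<epsilon>})"
      using H.edge_connectivity_le_edge_boundary[of e "{u}"] e u uv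
      by (simp add: edge_boundary_del_edges)
    also have "Suc \<dots> = k"
      using u k[OF u(1) uv(3)] card_Suc_Diff1[OF finite_edge_boundary u(2)]
      by (simp add: card_edge_boundary_singleton)
    finally have "Suc (edge_connectivity (del_edges G {\<epsilon>})) \<le> k"
      by simp
    moreover obtain A where A: "A \<subseteq> pverts G" "A \<noteq> {}" "e \<notin> A"
        "edge_connectivity (del_edges G {\<epsilon>}) = card (edge_boundary G A - {\<epsilon>})"
      using H.edge_connectivity_eq_edge_boundary[of e] e card
      by (auto simp: edge_boundary_del_edges)
    \<comment> \<open>Deleting one edge shrinks any cut by at most one.\<close>
    have "k \<le> Suc (edge_connectivity (del_edges G {\<epsilon>}))"
      using le[OF A(1-3)] card_Suc_Diff1[OF finite_edge_boundary, of \<epsilon> A] A(4)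
      by (cases "\<epsilon> \<in> edge_boundary G A") auto
    ultimately show ?thesis
      by simp
  qed
  ultimately show "minimally_edge_connected G"
    using card ec \<open>k > 0\<close> by (force simp: minimally_edge_connected_def)
qed

end

section \<open>Cyclic subgroups of finite groups\<close>

text \<open>With \<open>d = q ^ Suc n * m\<close> and \<open>q\<close> not dividing
  \<open>m\<close>, both sides of the divisibility have the factor \<open>q ^ n * (q - 1)\<close>;
  cancelling it leaves \<open>totient m dvd m\<close>. As \<open>m\<close> is odd and
  \<open>totient m\<close> is even for \<open>m > 2\<close>, this forces
  \<open>m = 1\<close>.\<close>

lemma prime_power_of_totient_dvd:
  fixes d q :: nat
  assumes q: "Factorial_Ring.prime q" "q dvd d" and d: "d > 0" "even d \<longrightarrow> q = 2"
    and dvd: "totient d dvd d - d div q"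
  obtains a where "a > 0" "d = q ^ a"
proof -
  obtain m where m: "d = q ^ multiplicity q d * m" "\<not> q dvd m"
    using multiplicity_decompose'[of d q] d q(1) by (metis not_prime_unit neq0_conv)
  have "multiplicity q d > 0"
    using q d by (simp add: prime_multiplicity_gt_zero_iff)
  then obtain n where n: "multiplicity q d = Suc n"
    using gr0_implies_Suc by blast
  have "q > 1"
    using q(1) by (rule prime_gt_1_nat)
  have "coprime (q ^ Suc n) m"
    using q(1) m(2) by (simp add: prime_imp_coprime)
  then have "totient d = q ^ n * (q - 1) * totient m"
    using m(1) n q(1) by (metis totient_mult_coprime totient_prime_power_Suc)
  moreover have "d - d div q = q ^ n * (q - 1) * m"
  proof -
    have "d = q * (q ^ n * m)"
      using m(1) n by simp
    then have "d div q = q ^ n * m"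
      using \<open>q > 1\<close> by (metis nonzero_mult_div_cancel_left not_one_less_zero)
    with \<open>d = q * (q ^ n * m)\<close> show ?thesis
      by (simp add: algebra_simps diff_mult_distrib)
  qed
  ultimately have "totient m dvd m"
    using dvd \<open>q > 1\<close> by simp
  \<comment> \<open>If \<open>d\<close> is even, then \<open>q = 2\<close> does not divide
    \<open>m\<close>; if \<open>d\<close> is odd, so is its divisor \<open>m\<close>.\<close>
  moreover have "odd m"
    using m d q by (metis dvd_mult)
  ultimately have "\<not> m > 2"
    using totient_even[of m] by (metis dvd_trans)
  then have "m = 1"
    using \<open>odd m\<close> by (metis One_nat_def dvd_0_right dvd_refl less_2_cases linorder_less_linear)
  then show ?thesis
    using that[of "Suc n"] m(1) n by simp
qed

locale finite_group = group +
  assumes finite_carrier: "finite (carrier G)"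
begin

lemma mem_generate_iff:
  assumes "x \<in> carrier G"
  shows "y \<in> generate G {x} \<longleftrightarrow> (\<exists>k::nat. y = x [^] k)"
  using generate_pow_on_finite_carrier[OF finite_carrier assms] by auto

lemma ord_pos: "x \<in> carrier G \<Longrightarrow> ord x > 0"
  using ord_ge_1[OF finite_carrier] by fastforce

text \<open>The exponent 0 can be replaced by \<open>ord x\<close>. The power graph admits positive
  exponents only.\<close>

lemma mem_generate_iff_pos:
  assumes "x \<in> carrier G"
  shows "y \<in> generate G {x} \<longleftrightarrow> (\<exists>k::nat. k > 0 \<and> y = x [^] k)"
proof -
  have "\<exists>l::nat. l > 0 \<and> x [^] k = x [^] l" for k :: nat
  proof (cases "k = 0")
    case True
    then show ?thesis
      using ord_pos assms by (intro exI[of _ "ord x"]) simp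
  qed auto
  then show ?thesis
    by (auto simp: mem_generate_iff[OF assms])
qed

lemma generate_subset_carrier: "x \<in> carrier G \<Longrightarrow> generate G {x} \<subseteq> carrier G"
  using generate_incl[of "{x}"] by simp

lemma finite_generate: "x \<in> carrier G \<Longrightarrow> finite (generate G {x})"
  using generate_subset_carrier finite_carrier finite_subset by blast

lemma generate_singleton_mono:
  assumes "x \<in> carrier G" "y \<in> generate G {x}"
  shows "generate G {y} \<subseteq> generate G {x}"
  using assms by (intro generate_subgroup_incl generate_is_subgroup) auto

lemma generate_singleton_eq:
  assumes "x \<in> carrier G" "y \<in> generate G {x}" "ord x \<le> ord y"
  shows "generate G {y} = generate G {x}"
proof (rule card_seteq)
  have "y \<in> carrier G"
    using assms generate_subset_carrier by blast
  then show "card (generate G {x}) \<le> card (generate G {y})"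
    using assms by (simp flip: generate_pow_card)
qed (use assms finite_generate generate_singleton_mono in auto)

lemma ord_dvd_of_mem_generate:
  assumes "x \<in> carrier G" "y \<in> generate G {x}"
  shows "ord y dvd ord x"
proof -
  obtain k :: nat where k: "y = x [^] k"
    using assms(2) mem_generate_iff[OF assms(1)] by auto
  then show ?thesis
    using assms by (metis nat_pow_closed nat_pow_one nat_pow_pow mult.commute pow_eq_id pow_ord_eq_1)
qed

text \<open>A cyclic group has only one subgroup of each order: any \<open>w\<close> in it generates
  the same subgroup as the power of \<open>y\<close> with exponent
  \<open>ord y div ord w\<close>.\<close>

lemma generate_singleton_eq_of_ord_eq:
  assumes y: "y \<in> carrier G" and u: "u \<in> generate G {y}" and v: "v \<in> generate G {y}"
    and "ord u = ord v"
  shows "generate G {u} = generate G {v}"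
proof -
  have "generate G {w} = generate G {y [^] (ord y div ord w)}" if wy: "w \<in> generate G {y}" for w
  proof -
    obtain k :: nat where k: "w = y [^] k"
      using wy mem_generate_iff[OF y] by auto
    then have w: "w \<in> carrier G"
      using y by simp
    have "ord w dvd ord y"
      using y wy by (rule ord_dvd_of_mem_generate)
    then obtain t where t: "ord y = t * ord w"
      by (metis dvdE mult.commute)
    \<comment> \<open>\<open>ord y = t * ord w\<close> divides \<open>k * ord w\<close>, so
      \<open>t\<close> divides \<open>k\<close> and \<open>w\<close> is a power of
      \<open>y [^] t\<close>.\<close>
    have "y [^] (k * ord w) = \<one>"
      using pow_ord_eq_1[OF w] unfolding k nat_pow_pow[OF y] .
    then have "t * ord w dvd k * ord w"
      using y t by (simp add: pow_eq_id)
    then have "t dvd k"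
      using ord_pos[OF w] by simp
    then obtain l where "k = t * l" ..
    then have "w \<in> generate G {y [^] t}"
      using k y by (auto simp: mem_generate_iff nat_pow_pow)
    moreover have "ord (y [^] t) = ord w"
      using ord_pow[of y t] t y ord_pos[OF y] by auto
    ultimately show ?thesis
      using y t ord_pos[OF w] by (simp add: generate_singleton_eq)
  qed
  then show ?thesis
    using assms by metis
qed

text \<open>A power \<open>x [^] k\<close> generates the same subgroup as \<open>x\<close> exactly
  when \<open>k\<close> is coprime to \<open>ord x\<close>.\<close>

lemma card_generators:
  assumes x: "x \<in> carrier G"
  shows "card {y \<in> carrier G. generate G {y} = generate G {x}} = totient (ord x)"
proof -
  have "{y \<in> carrier G. generate G {y} = generate G {x}} = (\<lambda>k. x [^] k) ` totatives (ord x)"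
  proof (intro equalityI subsetI)
    fix y assume "y \<in> {y \<in> carrier G. generate G {y} = generate G {x}}"
    then have y: "y \<in> carrier G" "generate G {y} = generate G {x}"
      by auto
    then have ord: "ord y = ord x"
      using x by (simp add: generate_pow_card)
    have "y \<in> generate G {x}"
      using y(2) generate.incl[of y "{y}" G] by simp
    then obtain k where k: "k < ord x" "y = x [^] k"
    proof -
      have "generate G {x} = {x [^] k | k. k \<in> {0..ord x - 1}}"
        using generate_pow_on_finite_carrier[OF finite_carrier x] ord_elems[OF finite_carrier x]
        by simp
      with \<open>y \<in> generate G {x}\<close> obtain k where "k \<le> ord x - 1" "y = x [^] k"
        by auto
      with that[of k] ord_pos[OF x] show ?thesis
        by simp
    qed
    \<comment> \<open>\<open>totatives\<close> starts at 1, so the exponent 0 is moved to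
      \<open>ord x\<close>.\<close>
    define l where "l = (if k = 0 then ord x else k)"
    have l: "y = x [^] l" "l \<in> {0<..ord x}"
      using k x ord_pos[OF x] by (auto simp: l_def)
    moreover have "coprime l (ord x)"
      using ord l(1) pow_ord_eq_ord_iff[OF finite_carrier x] by simp
    ultimately show "y \<in> (\<lambda>k. x [^] k) ` totatives (ord x)"
      by (auto simp: totatives_def)
  next
    fix y assume "y \<in> (\<lambda>k. x [^] k) ` totatives (ord x)"
    then obtain k where k: "y = x [^] k" "coprime k (ord x)"
      by (auto simp: totatives_def)
    then have "ord y = ord x"
      using pow_ord_eq_ord_iff[OF finite_carrier x] by simp
    moreover have "y \<in> generate G {x}"
      using k mem_generate_iff[OF x] by auto
    ultimately show "y \<in> {y \<in> carrier G. generate G {y} = generate G {x}}"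
      using k x generate_singleton_eq[OF x] by simp
  qed
  moreover have "inj_on (\<lambda>k. x [^] k) (totatives (ord x))"
    using ord_inj'[OF x] by (rule inj_on_subset) (auto simp: totatives_def)
  ultimately show ?thesis
    by (simp add: card_image totient_def)
qed

text \<open>Sorting \<open>S\<close> by generated subgroup splits it into full sets of generators,
  each of size \<open>totient d\<close>.\<close>

lemma totient_dvd_card:
  assumes S: "S \<subseteq> carrier G" "\<And>x. x \<in> S \<Longrightarrow> ord x = d"
    and closed: "\<And>x y. x \<in> S \<Longrightarrow> y \<in> carrier G \<Longrightarrow> generate G {y} = generate G {x} \<Longrightarrow> y \<in> S"
  shows "totient d dvd card S"
proof -
  let ?c = "\<lambda>x. generate G {x}"
  have "finite S"
    using S(1) finite_carrier finite_subset by blast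
  then have "card S = (\<Sum>C \<in> ?c ` S. card {x \<in> S. ?c x = C})"
    using sum.image_gen[of S "\<lambda>_. 1::nat" ?c] by simp
  also have "\<dots> = (\<Sum>C \<in> ?c ` S. totient d)"
  proof (intro sum.cong refl)
    fix C assume "C \<in> ?c ` S"
    then obtain x where x: "x \<in> S" "C = ?c x"
      by blast
    then have "{y \<in> S. ?c y = C} = {y \<in> carrier G. ?c y = ?c x}"
      using S closed by auto
    then show "card {y \<in> S. ?c y = C} = totient d"
      using card_generators x S by auto
  qed
  finally show ?thesis
    by simp
qed

section \<open>Cauchy's theorem and groups of prime power order\<close>

text \<open>Cauchy's theorem: Sylow with exponent 1 gives a subgroup of order \<open>r\<close>, and
  its nontrivial elements have order dividing \<open>r\<close>.\<close>

lemma exists_ord_prime: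
  fixes r :: nat
  assumes r: "Factorial_Ring.prime r" "r dvd order G"
  obtains x where "x \<in> carrier G" "ord x = r"
proof -
  obtain m where "order G = r ^ 1 * m"
    using r(2) by auto
  then obtain H where H: "subgroup H G" "card H = r"
    using sylow_thm[OF r(1) is_group _ finite_carrier] by fastforce
  have "card H > 1"
    using H(2) r(1) prime_gt_1_nat by simp
  then obtain x where x: "x \<in> H" "x \<noteq> \<one>"
    by (metis One_nat_def card_le_Suc0_iff_eq card.infinite less_nat_zero_code not_le)
  have xc: "x \<in> carrier G"
    using x(1) H(1) subgroup.subset by blast
  interpret H: group "G\<lparr>carrier := H\<rparr>"
    using H(1) by (rule subgroup_imp_group)
  have "x [^] r = \<one>"
    using H.pow_order_eq_1[of x] x(1) H(2) nat_pow_consistent[of x r H] by (simp add: order_def)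
  then have "ord x dvd r"
    using xc by (simp add: pow_eq_id)
  then have "ord x = r"
    using r(1) x(2) xc ord_eq_1 prime_nat_iff by blast
  with xc that show ?thesis
    by blast
qed

text \<open>By Cauchy's theorem, a prime factor of the group order other than \<open>q\<close> would
  be the order of an element.\<close>

lemma order_eq_prime_power:
  fixes q :: nat
  assumes q: "Factorial_Ring.prime q" and ord: "\<And>x. x \<in> carrier G \<Longrightarrow> ord x dvd q ^ a"
  obtains n where "order G = q ^ n"
proof -
  have "order G \<noteq> 0"
    using finite_carrier by (simp add: order_gt_0_iff_finite)
  then obtain m where m: "order G = q ^ multiplicity q (order G) * m" "\<not> q dvd m"
    using multiplicity_decompose'[of "order G" q] q by (metis not_prime_unit)
  have "m = 1"
  proof (rule ccontr)
    assume "m \<noteq> 1"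
    then obtain r where r: "Factorial_Ring.prime r" "r dvd m"
      using prime_factor_nat by blast
    then have "r dvd order G"
      using m(1) by (metis dvd_mult)
    then obtain x where "x \<in> carrier G" "ord x = r"
      using exists_ord_prime r(1) by blast
    then have "r dvd q ^ a"
      using ord by blast
    then have "r = q"
      using r(1) q by (metis prime_dvd_power primes_dvd_imp_eq)
    with r(2) m(2) show False
      by simp
  qed
  with m(1) that show ?thesis
    by (metis mult.right_neutral)
qed

text \<open>Class equation: the sizes of the conjugacy classes divide \<open>q ^ n\<close> and add
  up to it. The class of \<open>\<one>\<close> contributes 1, so some other class has size prime to
  \<open>q\<close>; it is a singleton, and its element is central.\<close>

lemma exists_central:
  fixes q :: nat
  assumes q: "Factorial_Ring.prime q" and n: "order G = q ^ n" "n > 0"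
  obtains x where "x \<in> carrier G" "x \<noteq> \<one>" "\<And>y. y \<in> carrier G \<Longrightarrow> x \<otimes> y = y \<otimes> x"
proof -
  let ?\<phi> = "\<lambda>g. \<lambda>h \<in> carrier G. g \<otimes> h \<otimes> inv g"
  interpret act: group_action G "carrier G" ?\<phi>
    by (rule action_by_conjugation)
  have fin: "finite (orbits G (carrier G) ?\<phi>)"
    using finite_carrier by (auto simp: orbits_def)
  have one: "orbit G ?\<phi> \<one> = {\<one>}"
    by (auto simp: orbit_def intro: exI[of _ \<one>])
  then have one': "{\<one>} \<in> orbits G (carrier G) ?\<phi>"
    unfolding orbits_def by force
  let ?S = "\<Sum>C \<in> orbits G (carrier G) ?\<phi> - {{\<one>}}. card C"
  have "order G = (\<Sum>C \<in> orbits G (carrier G) ?\<phi>. card C)"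
    using act.disjoint_sum[OF finite_carrier, of "\<lambda>_. 1::nat"] by (simp add: order_def)
  also have "\<dots> = Suc ?S"
    using fin one' by (simp add: sum.remove)
  finally have order: "order G = Suc ?S" .
  have "\<not> q dvd ?S"
  proof
    assume "q dvd ?S"
    moreover have "q dvd Suc ?S"
      using n unfolding order[symmetric] by simp
    ultimately have "q dvd 1"
      using dvd_diff_nat[of q "Suc ?S" ?S] by simp
    then show False
      using q by simp
  qed
  then obtain C where C: "C \<in> orbits G (carrier G) ?\<phi>" "C \<noteq> {\<one>}" "\<not> q dvd card C"
    using dvd_sum[of "orbits G (carrier G) ?\<phi> - {{\<one>}}" q card] by auto
  then obtain x where x: "x \<in> carrier G" "C = orbit G ?\<phi> x"
    by (auto simp: orbits_def)
  have "card C dvd q ^ n"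
    unfolding x(2) n(1)[symmetric] act.orbit_stabilizer_theorem[OF x(1), symmetric] by (rule dvd_triv_left)
  then obtain i where "card C = q ^ i"
    using divides_primepow_nat[OF q] by blast
  with C(3) have "card C = 1"
    by (cases i) auto
  then obtain c where "C = {c}"
    by (auto simp: card_1_singleton_iff)
  moreover have "x \<in> C"
    unfolding x(2) using x(1) by (rule act.orbit_refl)
  ultimately have single: "C = {x}"
    by simp
  have "x \<otimes> y = y \<otimes> x" if y: "y \<in> carrier G" for y
  proof -
    have "y \<otimes> x \<otimes> inv y \<in> C"
      using x y by (auto simp: orbit_def)
    then have "y \<otimes> x \<otimes> inv y = x"
      using single by simp
    then show ?thesis
      using x(1) y by (metis inv_solve_right m_closed)
  qed
  moreover have "x \<noteq> \<one>"
    using single C(2) by blast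
  ultimately show ?thesis
    using that x(1) by blast
qed

end

section \<open>Closed neighbourhoods in the power graph\<close>

lemma (in group) cyclic_group_iff_generate:
  "cyclic_group G \<longleftrightarrow> (\<exists>x \<in> carrier G. generate G {x} = carrier G)"
  by (auto simp: cyclic_group generate_pow full_SetCompr_eq)

context finite_group
begin

text \<open>For \<open>x\<close> in the group, \<open>x\<close> itself is included, so that sizes
  compare directly with orders of cyclic subgroups.\<close>

definition closed_neighbours :: "'a \<Rightarrow> 'a set" where
  "closed_neighbours x = {y \<in> carrier G. y \<in> generate G {x} \<or> x \<in> generate G {y}}"

lemma finite_closed_neighbours: "finite (closed_neighbours x)"
  using finite_carrier by (simp add: closed_neighbours_def)

lemma generate_subset_closed_neighbours:
  "x \<in> carrier G \<Longrightarrow> generate G {x} \<subseteq> closed_neighbours x"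
  using generate_subset_carrier by (auto simp: closed_neighbours_def)

lemma parcs_power_graph_iff:
  "(x, y) \<in> parcs (power_graph G) \<longleftrightarrow> x \<in> carrier G \<and> y \<in> closed_neighbours x \<and> x \<noteq> y"
proof (cases "x \<in> carrier G \<and> y \<in> carrier G")
  case True
  then show ?thesis
    using mem_generate_iff_pos[of x y] mem_generate_iff_pos[of y x]
    by (auto simp: power_graph_def closed_neighbours_def)
qed (auto simp: power_graph_def closed_neighbours_def)

lemma card_closed_neighbours:
  assumes "x \<in> carrier G"
  shows "card (closed_neighbours x) = Suc (card (neighbours (power_graph G) x))"
proof -
  have "neighbours (power_graph G) x = closed_neighbours x - {x}"
    using assms by (auto simp: neighbours_def parcs_power_graph_iff)
  moreover have "x \<in> closed_neighbours x"
    using assms by (auto simp: closed_neighbours_def intro: generate.incl)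
  ultimately show ?thesis
    using finite_closed_neighbours by (metis card_Suc_Diff1)
qed

lemma one_mem_closed_neighbours: "\<one> \<in> closed_neighbours x"
  by (simp add: closed_neighbours_def generate.one)

lemma closed_neighbours_one: "closed_neighbours \<one> = carrier G"
  by (auto simp: closed_neighbours_def generate.one)

lemma complete_power_graph_iff:
  "complete_graph (power_graph G) \<longleftrightarrow> (\<forall>x \<in> carrier G. closed_neighbours x = carrier G)"
proof -
  have "complete_graph (power_graph G) \<longleftrightarrow>
      (\<forall>x \<in> carrier G. \<forall>y \<in> carrier G. x \<noteq> y \<longrightarrow> (x, y) \<in> parcs (power_graph G))"
    using complete_graph_iff[OF pair_graph_power_graph[OF finite_carrier]]
    by (simp add: power_graph_def)
  also have "\<dots> \<longleftrightarrow> (\<forall>x \<in> carrier G. closed_neighbours x = carrier G)"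
    unfolding parcs_power_graph_iff
    by (auto simp: closed_neighbours_def intro: generate.incl)
  finally show ?thesis .
qed

text \<open>The identity serves as dominating vertex. Closed neighbourhoods exceed degrees by one,
  so one is constant iff the other is.\<close>

lemma minimally_edge_connected_power_graph_iff:
  assumes "carrier G \<noteq> {\<one>}"
  shows "minimally_edge_connected (power_graph G) \<longleftrightarrow>
    (\<exists>d. \<forall>x \<in> carrier G - {\<one>}. card (closed_neighbours x) = d)"
proof -
  interpret P: pair_graph "power_graph G"
    using finite_carrier by (rule pair_graph_power_graph)
  have V: "pverts (power_graph G) = carrier G"
    by (simp add: power_graph_def)
  obtain x where "x \<in> carrier G" "x \<noteq> \<one>"
    using assms one_closed by blast
  then have "card (carrier G) > 1"
    using card_mono[OF finite_carrier, of "{x, \<one>}"] by simp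
  then have "minimally_edge_connected (power_graph G) \<longleftrightarrow>
    (\<exists>k. \<forall>x \<in> carrier G - {\<one>}. card (neighbours (power_graph G) x) = k)"
    using P.minimally_edge_connected_iff_neighbours[of \<one>]
    by (simp add: V parcs_power_graph_iff one_mem_closed_neighbours)
  also have "\<dots> \<longleftrightarrow> (\<exists>d. \<forall>x \<in> carrier G - {\<one>}. card (closed_neighbours x) = d)"
  proof
    assume "\<exists>d. \<forall>x \<in> carrier G - {\<one>}. card (closed_neighbours x) = d"
    then obtain d where "\<forall>x \<in> carrier G - {\<one>}. card (closed_neighbours x) = d" ..
    then have "\<forall>x \<in> carrier G - {\<one>}. card (neighbours (power_graph G) x) = d - 1"
      by (auto simp: card_closed_neighbours)
    then show "\<exists>k. \<forall>x \<in> carrier G - {\<one>}. card (neighbours (power_graph G) x) = k" ..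
  qed (auto simp: card_closed_neighbours)
  finally show ?thesis .
qed

text \<open>Every nontrivial \<open>w\<close> in a cyclic \<open>q\<close>-group has a power of
  order \<open>q\<close>. That power generates the unique subgroup of order \<open>q\<close>, so
  \<open>x\<close> is a power of \<open>w\<close>.\<close>

lemma generate_subset_closed_neighbours_of_prime_power:
  fixes q :: nat
  assumes q: "Factorial_Ring.prime q" and y: "y \<in> carrier G" "ord y = q ^ a"
    and x: "x \<in> generate G {y}" "ord x = q"
  shows "generate G {y} \<subseteq> closed_neighbours x"
proof
  fix w assume w: "w \<in> generate G {y}"
  have carr: "w \<in> carrier G" "x \<in> carrier G"
    using y(1) w x(1) generate_subset_carrier by auto
  show "w \<in> closed_neighbours x"
  proof (cases "w = \<one>")
    case False
    have "ord w dvd q ^ a"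
      using ord_dvd_of_mem_generate[OF y(1) w] y(2) by simp
    then obtain i where i: "ord w = q ^ i"
      using divides_primepow_nat[OF q] by blast
    have "i \<noteq> 0"
      using i False ord_eq_1[OF carr(1)] by (metis power_0)
    then obtain j where j: "ord w = q ^ j * q"
      using i by (cases i) auto
    let ?v = "w [^] (q ^ j)"
    have "q > 0"
      using q by (rule prime_gt_0_nat)
    have "ord ?v = ord x"
      using ord_pow[OF carr(1), of "q ^ j"] j x(2) \<open>q > 0\<close> by simp
    moreover have vw: "?v \<in> generate G {w}"
      using mem_generate_iff[OF carr(1)] by auto
    then have "?v \<in> generate G {y}"
      using generate_singleton_mono[OF y(1) w] by blast
    ultimately have "generate G {?v} = generate G {x}"
      using y(1) x(1) by (intro generate_singleton_eq_of_ord_eq)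
    then have "x \<in> generate G {?v}"
      using generate.incl[of x "{x}" G] by simp
    then have "x \<in> generate G {w}"
      using generate_singleton_mono[OF carr(1) vw] by blast
    then show ?thesis
      using carr by (simp add: closed_neighbours_def)
  qed (simp add: one_mem_closed_neighbours)
qed

end

section \<open>Groups with closed neighbourhoods of equal size\<close>

locale equal_closed_neighbours = finite_group +
  fixes d :: nat
  assumes nontrivial: "carrier G \<noteq> {\<one>}"
    and card_eq: "\<And>x. x \<in> carrier G \<Longrightarrow> x \<noteq> \<one> \<Longrightarrow> card (closed_neighbours x) = d"
begin

text \<open>Among the elements that have \<open>x\<close> as a power, one of maximal order generates
  a maximal cyclic subgroup. Its closed neighbourhood is that subgroup, whose order is therefore
  \<open>d\<close>.\<close>

lemma obtain_ord_eq:
  assumes x: "x \<in> carrier G" "x \<noteq> \<one>"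
  obtains y where "y \<in> carrier G" "x \<in> generate G {y}" "ord y = d"
proof -
  let ?S = "{y \<in> carrier G. x \<in> generate G {y}}"
  have S: "finite ?S" "x \<in> ?S"
    using x finite_carrier by (auto intro: generate.incl)
  then have "Max (ord ` ?S) \<in> ord ` ?S"
    by (intro Max_in) auto
  then obtain y where y: "y \<in> ?S" "ord y = Max (ord ` ?S)"
    by auto
  then have yc: "y \<in> carrier G" and xy: "x \<in> generate G {y}"
    by auto
  have max: "ord z \<le> ord y" if "z \<in> ?S" for z
    unfolding y(2) using S that by (intro Max_ge) auto
  have "y \<noteq> \<one>"
    using xy x(2) generate_one by auto
  have "z \<in> generate G {y}" if z: "z \<in> carrier G" "y \<in> generate G {z}" for z
  proof -
    have "x \<in> generate G {z}"
      using generate_singleton_mono[OF z] xy by blast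
    then have "ord z \<le> ord y"
      using max z by blast
    then have "generate G {y} = generate G {z}"
      using generate_singleton_eq[OF z] by blast
    then show ?thesis
      using generate.incl[of z "{z}" G] by simp
  qed
  then have "closed_neighbours y = generate G {y}"
    using generate_subset_closed_neighbours[OF yc] by (auto simp: closed_neighbours_def)
  then have "ord y = d"
    using card_eq[OF yc \<open>y \<noteq> \<one>\<close>] generate_pow_card[OF yc] by simp
  with yc xy that show ?thesis
    by blast
qed

lemma ord_dvd:
  assumes "x \<in> carrier G"
  shows "ord x dvd d"
proof (cases "x = \<one>")
  case False
  with assms obtain y where "y \<in> carrier G" "x \<in> generate G {y}" "ord y = d"
    by (rule obtain_ord_eq)
  then show ?thesis
    using ord_dvd_of_mem_generate by blast
qed simp

lemma obtain_ord_d: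
  obtains g where "g \<in> carrier G" "ord g = d"
proof -
  obtain x where "x \<in> carrier G" "x \<noteq> \<one>"
    using nontrivial one_closed by blast
  then show ?thesis
    using obtain_ord_eq that by blast
qed

lemma d_gt_1: "d > 1"
proof -
  obtain x where x: "x \<in> carrier G" "x \<noteq> \<one>"
    using nontrivial one_closed by blast
  then have "ord x dvd d" "ord x \<noteq> 1"
    using ord_dvd ord_eq_1 by blast+
  moreover obtain g where "g \<in> carrier G" "ord g = d"
    by (rule obtain_ord_d)
  then have "d > 0"
    using ord_pos by blast
  ultimately show ?thesis
    by (metis dvd_1_iff_1 One_nat_def nat_neq_iff less_one)
qed

text \<open>The order of a neighbour of \<open>z\<close> outside \<open>generate G {z}\<close> is a
  proper multiple of \<open>d div q\<close> and divides \<open>d\<close>; as \<open>q\<close> is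
  prime, it is \<open>d\<close>. There are \<open>d - d div q\<close> such neighbours, and they are
  closed under change of generator.\<close>

lemma totient_dvd:
  fixes q :: nat
  assumes q: "Factorial_Ring.prime q" "q dvd d" "q \<noteq> d"
  shows "totient d dvd d - d div q"
proof -
  obtain g where g: "g \<in> carrier G" "ord g = d"
    by (rule obtain_ord_d)
  define z where "z = g [^] q"
  have "q > 0"
    using q(1) by (rule prime_gt_0_nat)
  have z: "z \<in> carrier G" "ord z = d div q"
    using g q(2) ord_pow[OF g(1)] \<open>q > 0\<close> by (auto simp: z_def)
  obtain t where t: "d = q * t"
    using q(2) by blast
  have "d div q = t" "t > 0" "t \<noteq> 1"
    using t \<open>q > 0\<close> q(3) d_gt_1 by (auto intro: Nat.gr0I)
  \<comment> \<open>This is where \<open>q \<noteq> d\<close> enters; it makes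
    \<open>card_eq\<close> applicable to \<open>z\<close>.\<close>
  then have "z \<noteq> \<one>"
    using z by auto
  have "t < d"
    using t \<open>t > 0\<close> prime_gt_1_nat[OF q(1)] by simp
  define S where "S = {y \<in> carrier G. ord y = d \<and> z \<in> generate G {y}}"
  have "closed_neighbours z = generate G {z} \<union> S"
  proof (intro equalityI subsetI)
    fix y assume y: "y \<in> closed_neighbours z"
    show "y \<in> generate G {z} \<union> S"
    proof (cases "y \<in> generate G {z}")
      case False
      with y have y: "y \<in> carrier G" "z \<in> generate G {y}"
        by (auto simp: closed_neighbours_def)
      then have "t dvd ord y" "ord y dvd q * t"
        using ord_dvd_of_mem_generate[OF y] z(2) \<open>d div q = t\<close> ord_dvd[OF y(1)] t by simp_all
      then obtain s where s: "ord y = t * s" "s dvd q"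
        using \<open>t > 0\<close> by (auto simp: mult.commute)
      have "s \<noteq> 1"
      proof
        assume "s = 1"
        then have "generate G {z} = generate G {y}"
          using s(1) z(2) \<open>d div q = t\<close> by (intro generate_singleton_eq y) simp
        then show False
          using False generate.incl[of y "{y}" G] by simp
      qed
      then have "s = q"
        using s(2) q(1) prime_nat_iff by blast
      then show ?thesis
        using y s(1) t by (simp add: S_def mult.commute)
    qed simp
  qed (use generate_subset_closed_neighbours[OF z(1)] in \<open>auto simp: S_def closed_neighbours_def\<close>)
  moreover have "ord y < d" if "y \<in> generate G {z}" for y
    using dvd_imp_le[OF ord_dvd_of_mem_generate[OF z(1) that]] z(2) \<open>d div q = t\<close> \<open>t < d\<close> \<open>t > 0\<close>
    by simp
  then have "generate G {z} \<inter> S = {}"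
    by (auto simp: S_def)
  moreover have "finite S"
    using finite_carrier by (simp add: S_def)
  ultimately have "d = d div q + card S"
    using card_Un_disjoint[of "generate G {z}" S] finite_generate[OF z(1)]
      generate_pow_card[OF z(1)] card_eq[OF z(1) \<open>z \<noteq> \<one>\<close>] z(2) by simp
  moreover have "totient d dvd card S"
  proof (rule totient_dvd_card)
    fix x y assume *: "x \<in> S" "y \<in> carrier G" "generate G {y} = generate G {x}"
    then have "x \<in> carrier G"
      by (simp add: S_def)
    then have "ord y = ord x"
      using * generate_pow_card by metis
    with * show "y \<in> S"
      by (simp add: S_def)
  qed (auto simp: S_def)
  ultimately show ?thesis
    by (metis add_diff_cancel_left')
qed

text \<open>Multiplying by a central element \<open>x\<close> of order \<open>q\<close> does not change \<open>q\<close>-th powers. Every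
  element of order \<open>q\<close> in a maximal cyclic subgroup \<open>\<langle>y\<rangle>\<close> is such a power, and it lies in no
  other maximal cyclic subgroup, so \<open>y \<otimes> x\<close> and hence \<open>x\<close> belong to \<open>\<langle>y\<rangle>\<close>.\<close>

lemma prime_power_imp_closed_neighbours_eq_carrier:
  fixes q :: nat
  assumes q: "Factorial_Ring.prime q" and d: "d = q ^ a" "a \<ge> 2"
  obtains x where "x \<in> carrier G" "x \<noteq> \<one>" "closed_neighbours x = carrier G"
proof -
  have "q > 1"
    using q by (rule prime_gt_1_nat)
  obtain b where b: "a = Suc (Suc b)"
    using d(2) by (metis add_2_eq_Suc le_Suc_ex)
  obtain n where n: "order G = q ^ n"
    using order_eq_prime_power[OF q, of a] ord_dvd d(1) by blast
  have "n > 0"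
  proof (rule ccontr)
    assume "\<not> n > 0"
    then have "card (carrier G) = 1"
      using n by (simp add: order_def)
    then show False
      using nontrivial one_closed by (metis card_1_singletonE singletonD)
  qed
  then obtain c where c: "c \<in> carrier G" "c \<noteq> \<one>" "\<And>y. y \<in> carrier G \<Longrightarrow> c \<otimes> y = y \<otimes> c"
    using exists_central[OF q n] by blast
  obtain i where i: "ord c = q ^ i"
    using ord_dvd[OF c(1)] d(1) divides_primepow_nat[OF q] by blast
  have "i \<noteq> 0"
    using i c(2) ord_eq_1[OF c(1)] by (metis power_0)
  then obtain j where j: "ord c = q ^ j * q"
    using i by (cases i) auto
  define x where "x = c [^] (q ^ j)"
  have x: "x \<in> carrier G" "ord x = q"
    using c(1) ord_pow[OF c(1), of "q ^ j"] j \<open>q > 1\<close> by (auto simp: x_def)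
  have "x \<noteq> \<one>"
    using x(2) \<open>q > 1\<close> by auto
  have comm: "y \<otimes> x = x \<otimes> y" if "y \<in> carrier G" for y
    using c that unfolding x_def by (metis group_commutes_pow)
  have sub: "generate G {y} \<subseteq> closed_neighbours u"
    if "y \<in> carrier G" "ord y = d" "u \<in> generate G {y}" "ord u = q" for y u
    using generate_subset_closed_neighbours_of_prime_power[OF q, of y a u] that d(1) by simp
  have "w \<in> closed_neighbours x" if w: "w \<in> carrier G" "w \<noteq> \<one>" for w
  proof -
    obtain y where y: "y \<in> carrier G" "w \<in> generate G {y}" "ord y = d"
      using obtain_ord_eq[OF w] .
    \<comment> \<open>The exponent is \<open>d div q\<close>, so \<open>s\<close> has order
      \<open>q\<close>. Since \<open>a \<ge> 2\<close>, it is a multiple of \<open>q\<close> and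
      kills \<open>x\<close>.\<close>
    let ?k = "q ^ Suc b"
    define s where "s = y [^] ?k"
    have dk: "d = ?k * q"
      using d(1) b by simp
    have s: "s \<in> carrier G" "ord s = q" "s \<in> generate G {y}"
      using y(1,3) ord_pow[OF y(1), of ?k] dk \<open>q > 1\<close> mem_generate_iff[OF y(1)]
      by (auto simp: s_def)
    have "s \<noteq> \<one>"
      using s(2) \<open>q > 1\<close> by auto
    have "x [^] ?k = \<one>"
      using x by (simp add: pow_eq_id)
    then have "(y \<otimes> x) [^] ?k = s"
      using pow_mult_distrib[OF comm[OF y(1)] y(1) x(1), of ?k] s(1) by (simp add: s_def)
    then have "s \<in> generate G {y \<otimes> x}"
      using mem_generate_iff[of "y \<otimes> x"] y(1) x(1) by auto
    then have "y \<otimes> x \<in> closed_neighbours s"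
      using y(1) x(1) by (simp add: closed_neighbours_def)
    \<comment> \<open>The inclusion from right to left is an equality because both sets have size
      \<open>d\<close>.\<close>
    moreover have "closed_neighbours s = generate G {y}"
      using sub[OF y(1,3) s(3,2)] card_eq[OF s(1) \<open>s \<noteq> \<one>\<close>] generate_pow_card[OF y(1)] y(3)
      by (metis card_subset_eq finite_closed_neighbours)
    ultimately have "y \<otimes> x \<in> generate G {y}"
      by simp
    then have "inv y \<otimes> (y \<otimes> x) \<in> generate G {y}"
      by (intro generate.eng[of "inv y"] generate.inv) simp_all
    then have "x \<in> generate G {y}"
      using x(1) y(1) by (simp flip: m_assoc)
    \<comment> \<open>Now \<open>x\<close> is an element of order \<open>q\<close> in the cyclic
      \<open>q\<close>-group generated by \<open>y\<close>, hence adjacent or equal to each of its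
      elements, in particular \<open>w\<close>.\<close>
    then show ?thesis
      using sub[OF y(1,3) _ x(2)] y(2) by blast
  qed
  then have "closed_neighbours x = carrier G"
    using one_mem_closed_neighbours by (auto simp: closed_neighbours_def)
  with x(1) \<open>x \<noteq> \<one>\<close> that show ?thesis
    by blast
qed

text \<open>One full closed neighbourhood gives \<open>d = card (carrier G)\<close>, and then all of
  them are full.\<close>

lemma closed_neighbours_eq_carrier_imp_complete:
  assumes "x \<in> carrier G" "x \<noteq> \<one>" "closed_neighbours x = carrier G"
  shows "complete_graph (power_graph G)"
proof -
  have "closed_neighbours y = carrier G" if "y \<in> carrier G" for y
  proof (cases "y = \<one>")
    case False
    have "card (closed_neighbours y) = card (carrier G)"
      using card_eq assms that False by metis
    then show ?thesis
      using finite_carrier by (intro card_subset_eq) (auto simp: closed_neighbours_def)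
  qed (simp add: closed_neighbours_one)
  then show ?thesis
    by (simp add: complete_power_graph_iff)
qed

lemma prime_exponent_of_not_complete:
  assumes "\<not> complete_graph (power_graph G)"
  shows "prime_exponent G"
proof -
  \<comment> \<open>The prime 2 if \<open>d\<close> is even, any prime factor otherwise, as the
    parity argument requires.\<close>
  obtain q where q: "Factorial_Ring.prime q" "q dvd d" "even d \<longrightarrow> q = 2"
    using prime_factor_nat[of d] d_gt_1 two_is_prime_nat by (metis less_irrefl_nat)
  have "q = d"
  proof (rule ccontr)
    assume "q \<noteq> d"
    then have "totient d dvd d - d div q"
      using q by (intro totient_dvd)
    then obtain a where a: "a > 0" "d = q ^ a"
      using prime_power_of_totient_dvd q d_gt_1 by (metis One_nat_def Suc_lessD)
    with \<open>q \<noteq> d\<close> have "a \<ge> 2"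
      by (cases "a = 1") auto
    then show False
      using prime_power_imp_closed_neighbours_eq_carrier[OF q(1) a(2)]
        closed_neighbours_eq_carrier_imp_complete assms by blast
  qed
  then show ?thesis
    using q(1) ord_dvd pow_eq_id unfolding prime_exponent_def by blast
qed

lemma not_cyclic_of_not_complete:
  assumes "\<not> complete_graph (power_graph G)"
  shows "\<not> cyclic_group G"
proof
  assume "cyclic_group G"
  then obtain x where x: "x \<in> carrier G" "generate G {x} = carrier G"
    by (auto simp: cyclic_group_iff_generate)
  have "x \<noteq> \<one>"
    using x(2) nontrivial generate_one by auto
  moreover have "closed_neighbours x = carrier G"
    using generate_subset_closed_neighbours[OF x(1)] x(2) by (auto simp: closed_neighbours_def)
  ultimately show False
    using closed_neighbours_eq_carrier_imp_complete x(1) assms by blast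
qed

end

section \<open>Prime exponent and the equivalence\<close>

text \<open>All nontrivial elements have order \<open>p\<close>, so a cyclic subgroup containing
  \<open>x\<close> has the same order as the one generated by \<open>x\<close> and equals
  it.\<close>

lemma (in finite_group) closed_neighbours_of_prime_exponent:
  fixes p :: nat
  assumes p: "Factorial_Ring.prime p" "\<forall>x \<in> carrier G. x [^] p = \<one>"
    and x: "x \<in> carrier G" "x \<noteq> \<one>"
  shows "closed_neighbours x = generate G {x}" "ord x = p"
proof -
  have ord: "ord y = p" if "y \<in> carrier G" "y \<noteq> \<one>" for y
  proof -
    have "ord y dvd p" "ord y \<noteq> 1"
      using that p(2) ord_eq_1 by (auto simp flip: pow_eq_id)
    then show ?thesis
      using p(1) prime_nat_iff by blast
  qed
  then show "ord x = p"
    using x by blast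
  have "y \<in> generate G {x}" if y: "y \<in> carrier G" "x \<in> generate G {y}" for y
  proof -
    have "y \<noteq> \<one>"
      using y(2) x(2) generate_one by auto
    then have "generate G {x} = generate G {y}"
      using ord x y by (intro generate_singleton_eq) auto
    then show ?thesis
      using generate.incl[of y "{y}" G] by simp
  qed
  then show "closed_neighbours x = generate G {x}"
    using generate_subset_closed_neighbours[OF x(1)] by (auto simp: closed_neighbours_def)
qed

theorem theorem1p1:
  fixes G (structure)
  assumes "group G" and "finite (carrier G)"
  shows "(\<not> cyclic_group G \<and> prime_exponent G) \<longleftrightarrow>
         (\<not> complete_graph (power_graph G) \<and> minimally_edge_connected (power_graph G))"
proof -
  interpret finite_group G
    using assms by (simp add: finite_group_def finite_group_axioms_def)
  show ?thesis
  proof (cases "carrier G = {\<one>}")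
    \<comment> \<open>Both sides fail for the trivial group: it is cyclic and its power graph is
      complete.\<close>
    case True
    then have "cyclic_group G"
      by (intro trivial_imp_cyclic_group) (simp add: trivial_group_def is_group)
    moreover have "complete_graph (power_graph G)"
      using True by (simp add: complete_power_graph_iff closed_neighbours_one)
    ultimately show ?thesis
      by simp
  next
    case nontrivial: False
    show ?thesis
    proof
      assume L: "\<not> cyclic_group G \<and> prime_exponent G"
      then obtain p :: nat where p: "Factorial_Ring.prime p" "\<forall>x \<in> carrier G. x [^] p = \<one>"
        by (auto simp: prime_exponent_def)
      note nbhd = closed_neighbours_of_prime_exponent[OF p]
      have "\<forall>x \<in> carrier G - {\<one>}. card (closed_neighbours x) = p"
        using nbhd generate_pow_card by auto
      then have "minimally_edge_connected (power_graph G)"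
        using minimally_edge_connected_power_graph_iff[OF nontrivial] by blast
      moreover have "\<not> complete_graph (power_graph G)"
      \<comment> \<open>In a complete power graph, the subgroup generated by a nontrivial
        \<open>x\<close>, being its closed neighbourhood, would be the whole group.\<close>
      proof
        assume "complete_graph (power_graph G)"
        moreover obtain x where x: "x \<in> carrier G" "x \<noteq> \<one>"
          using nontrivial one_closed by blast
        ultimately have "generate G {x} = carrier G"
          using nbhd(1)[OF x] by (simp add: complete_power_graph_iff)
        then have "cyclic_group G"
          using x(1) by (auto simp: cyclic_group_iff_generate)
        with L show False
          by simp
      qed
      ultimately show "\<not> complete_graph (power_graph G) \<and> minimally_edge_connected (power_graph G)"
        by simp
    next
      assume R: "\<not> complete_graph (power_graph G) \<and> minimally_edge_connected (power_graph G)"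
      then obtain d where "\<forall>x \<in> carrier G - {\<one>}. card (closed_neighbours x) = d"
        using minimally_edge_connected_power_graph_iff[OF nontrivial] by blast
      then interpret equal_closed_neighbours G d
        using nontrivial by unfold_locales auto
      show "\<not> cyclic_group G \<and> prime_exponent G"
        using R prime_exponent_of_not_complete not_cyclic_of_not_complete by blast
    qed
  qed
qed

end
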